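(* Let $f:\mathbb{R}^n\to\mathbb{R}$ be differentiable, $\mu$-strongly convex and $L$-smooth with minimizer $x^*$, $f^*=f(x^* )$ and condition number $C_f=L/\mu$. Write $E_k^{SC}=f(x_k)-f^*+\frac\mu2|v_k-x^*|^2$. Let $(x_0,v_0)$ be an initial condition satisfying $$0<E_0^{SC}\le \frac{2\sigma^2}{\sqrt{\mu L}}.$$ For $k\ge 0$ let $$h_k=\frac{2}{\sqrt\mu\,(k+k_0)},\qquad k_0=\max\left\{2\sqrt{C_f},\ \frac{4\sigma^2}{\mu E_0^{SC}}\right\},\qquad w_k=\frac{h_k\sqrt\mu}{1+h_k\sqrt\mu},$$ and let $x_k,v_k$ be generated by $$y_k=(1-w_k)x_k+w_kv_k,$$ $$x_{k+1}-x_k=w_k(v_k-x_k)-\frac{h_k}{\sqrt L}(\nabla f(y_k)+e_k),$$ $$v_{k+1}-v_k=w_k(x_k-v_k)-\frac{h_k}{\sqrt\mu}(\nabla f(y_k)+e_k).$$ Then, for all $k\ge0$, $$\mathbb{E}[E_k^{SC}]\le\frac{4\sigma^2}{\mu(k+k_0)}.$$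
   Context: $f$ is $L$-smooth if $f(y)-f(x)+\nabla f(x)\cdot(x-y)\le \frac L2|x-y|^2$ for all $x,y$. $f$ is $\mu$-strongly convex ($\mu>0$) if $f(x)+\nabla f(x)\cdot(y-x)\le f(y)-\frac\mu2|x-y|^2$ for all $x,y$. Stochastic gradient model: the stochastic gradient is $\widehat g(x,\xi)=\nabla f(x)+e(x,\xi)$, where for every $x$ one has $\mathbb{E}[e(x,\xi)]=0$ and $\mathrm{Var}(e(x,\xi))\le\sigma^2$, i.e. $\mathbb{E}[|e(x,\xi)|^2]\le\sigma^2$. At step $k$ the error is $e_k=e(y_k,\xi_k)$, with $\xi_k$ a fresh sample independent of the past, so that conditionally on the past (on $x_0,v_0,\xi_0,\dots,\xi_{k-1}$) $e_k$ has mean $0$ and $\mathbb{E}[|e_k|^2]\le\sigma^2$. The initial condition $(x_0,v_0)$ is deterministic. *)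

theory Defs
  imports "HOL-Probability.Probability"
begin

definition grad :: "('a::euclidean_space \<Rightarrow> real) \<Rightarrow> 'a \<Rightarrow> 'a" where
  "grad f x = (THE D. GDERIV f x :> D)"

lemma GDERIV_grad:
  fixes f :: "'a::euclidean_space \<Rightarrow> real"
  assumes "f differentiable (at x)"
  shows "GDERIV f x :> grad f x"
proof -
  from assms obtain f' where f': "(f has_derivative f') (at x)"
    unfolding differentiable_def by blast
  then interpret f': bounded_linear f' by (rule has_derivative_bounded_linear)
  define D where "D = (\<Sum>b\<in>Basis. f' b *\<^sub>R b)"
  have "f' h = h \<bullet> D" for h
  proof -
    have "f' h = f' (\<Sum>b\<in>Basis. (h \<bullet> b) *\<^sub>R b)"
      by (simp add: euclidean_representation)
    also have "\<dots> = h \<bullet> D"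
      by (simp add: f'.sum f'.scaleR D_def inner_sum_right mult.commute)
    finally show ?thesis .
  qed
  hence "f' = (\<lambda>h. h \<bullet> D)" by blast
  with f' have D: "GDERIV f x :> D" by (simp add: gderiv_def)
  have "D' = D" if "GDERIV f x :> D'" for D'
  proof -
    have "(\<lambda>h. h \<bullet> D') = (\<lambda>h. h \<bullet> D)"
      using that D unfolding gderiv_def by (rule has_derivative_unique)
    hence "h \<bullet> (D' - D) = 0" for h by (metis inner_diff_right right_minus_eq)
    thus ?thesis by (metis inner_eq_zero_iff right_minus_eq)
  qed
  with D show ?thesis unfolding grad_def by (metis theI)
qed

definition L_smooth :: "real \<Rightarrow> ('a::euclidean_space \<Rightarrow> real) \<Rightarrow> bool" where
  "L_smooth L f \<longleftrightarrow>
     (\<forall>x y. f y - f x + grad f x \<bullet> (x - y) \<le> L / 2 * (norm (x - y))\<^sup>2)"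

definition strongly_convex :: "real \<Rightarrow> ('a::euclidean_space \<Rightarrow> real) \<Rightarrow> bool" where
  "strongly_convex \<mu> f \<longleftrightarrow> \<mu> > 0 \<and>
     (\<forall>x y. f x + grad f x \<bullet> (y - x) \<le> f y - \<mu> / 2 * (norm (x - y))\<^sup>2)"

definition is_minimizer :: "('a \<Rightarrow> real) \<Rightarrow> 'a \<Rightarrow> bool" where
  "is_minimizer f xs \<longleftrightarrow> (\<forall>x. f xs \<le> f x)"

text \<open>
  The measure \<open>P\<close> is the law of a sample \<open>\<xi>\<close>, so expectations of \<open>e x \<xi>\<close> are
  integrals over \<open>P\<close>.  Joint measurability of \<open>e\<close> makes \<open>e (y \<omega>) (\<xi> \<omega>)\<close> a random
  variable whenever \<open>y\<close> is one.  Integrability is explicit because the Bochner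
  integral of a non-integrable function is \<open>0\<close>.
\<close>

definition gradient_noise ::
    "'s measure \<Rightarrow> ('a::euclidean_space \<Rightarrow> 's \<Rightarrow> 'a) \<Rightarrow> real \<Rightarrow> bool" where
  "gradient_noise P e \<sigma> \<longleftrightarrow>
     prob_space P \<and>
     (\<lambda>(x, s). e x s) \<in> borel_measurable (borel \<Otimes>\<^sub>M P) \<and>
     (\<forall>x. integrable P (e x) \<and> (LINT s|P. e x s) = 0 \<and>
          integrable P (\<lambda>s. (norm (e x s))\<^sup>2) \<and>
          (LINT s|P. (norm (e x s))\<^sup>2) \<le> \<sigma>\<^sup>2)"

text \<open>
  Each \<open>\<xi> k\<close> has law \<open>P\<close> and is independent of the \<open>\<sigma>\<close>-algebra generated by
  the earlier samples.  This is phrased with \<open>indep_set\<close> because \<open>indep_var\<close> requires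
  both variables to have the same type.
\<close>

definition fresh_samples :: "'w measure \<Rightarrow> 's measure \<Rightarrow> (nat \<Rightarrow> 'w \<Rightarrow> 's) \<Rightarrow> bool" where
  "fresh_samples M P \<xi> \<longleftrightarrow>
     (\<forall>k. \<xi> k \<in> measurable M P \<and> distr M P (\<xi> k) = P \<and>
          prob_space.indep_set M
            (sets (vimage_algebra (space M) (\<lambda>\<omega>. \<lambda>i\<in>{..<k}. \<xi> i \<omega>)
                     (Pi\<^sub>M {..<k} (\<lambda>_. P))))
            (sets (vimage_algebra (space M) (\<xi> k) P)))"

definition E_SC ::
    "('a::euclidean_space \<Rightarrow> real) \<Rightarrow> real \<Rightarrow> 'a \<Rightarrow> 'a \<Rightarrow> 'a \<Rightarrow> real" where
  "E_SC f \<mu> xs x v = f x - f xs + \<mu> / 2 * (norm (v - xs))\<^sup>2"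

end

(*
  Put a = h sqrt(mu).  Smoothness at y bounds f(x'), convexity of the squared norm bounds
  |v' - xs|^2 (x', v' the next iterates), and strong convexity at y relates f(y) to f(x) and
  f(xs).  As h <= 1/sqrt(L), the terms in |grad f(y)|^2 have nonpositive sum, and pointwise
    E' <= (1 - a) E + Q . e + h^2 |e|^2
  with Q a function of the past.  The cross term has mean zero because the sample is fresh.
  With t = k + k0 and B = 4 sigma^2/mu the expectations satisfy
    E_(k+1) <= (1 - 2/t) E_k + B/t^2,
  so E_k <= B/t gives E_(k+1) <= B (t - 1)/t^2 <= B/(t + 1); the choice of k0 starts the induction.
*)

theory Submission
  imports Defs
begin

section \<open>Square-integrable random vectors\<close>

text \<open>The iterates, the gradients along them and the noise all stay in this class.
  Integrability of the energy and of the cross term with the noise is derived from it.\<close>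

definition square_integrable :: "'w measure \<Rightarrow> ('w \<Rightarrow> 'a::euclidean_space) \<Rightarrow> bool" where
  "square_integrable M X \<longleftrightarrow>
     X \<in> borel_measurable M \<and> integrable M (\<lambda>\<omega>. (norm (X \<omega>))\<^sup>2)"

lemma square_integrable_inner:
  fixes X Y :: "'w \<Rightarrow> 'a::euclidean_space"
  assumes "square_integrable M X" "square_integrable M Y"
  shows "integrable M (\<lambda>\<omega>. X \<omega> \<bullet> Y \<omega>)"
proof (rule Bochner_Integration.integrable_bound)
  show "integrable M (\<lambda>\<omega>. (norm (X \<omega>))\<^sup>2 + (norm (Y \<omega>))\<^sup>2)"
    using assms by (auto simp: square_integrable_def)
  show "(\<lambda>\<omega>. X \<omega> \<bullet> Y \<omega>) \<in> borel_measurable M"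
    using assms by (auto simp: square_integrable_def)
  have "\<bar>a \<bullet> b\<bar> \<le> (norm a)\<^sup>2 + (norm b)\<^sup>2" for a b :: 'a
  proof -
    have "\<bar>a \<bullet> b\<bar> \<le> norm a * norm b" by (rule Cauchy_Schwarz_ineq2)
    moreover have "0 \<le> (norm a - norm b)\<^sup>2" by simp
    moreover have "0 \<le> norm a * norm b" by simp
    ultimately show ?thesis unfolding power2_diff by linarith
  qed
  then show "AE \<omega> in M. norm (X \<omega> \<bullet> Y \<omega>) \<le> norm ((norm (X \<omega>))\<^sup>2 + (norm (Y \<omega>))\<^sup>2)"
    by simp
qed

lemma square_integrable_add:
  fixes X Y :: "'w \<Rightarrow> 'a::euclidean_space"
  assumes "square_integrable M X" "square_integrable M Y"
  shows "square_integrable M (\<lambda>\<omega>. X \<omega> + Y \<omega>)"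
proof -
  have "integrable M (\<lambda>\<omega>. (norm (X \<omega>))\<^sup>2 + (norm (Y \<omega>))\<^sup>2 + 2 * (X \<omega> \<bullet> Y \<omega>))"
    using assms square_integrable_inner[OF assms] by (auto simp: square_integrable_def)
  moreover have "(norm (a + b))\<^sup>2 = (norm a)\<^sup>2 + (norm b)\<^sup>2 + 2 * (a \<bullet> b)" for a b :: 'a
    by (simp add: power2_norm_eq_inner inner_simps inner_commute)
  ultimately show ?thesis
    using assms by (auto simp: square_integrable_def)
qed

lemma square_integrable_scaleR:
  "square_integrable M X \<Longrightarrow> square_integrable M (\<lambda>\<omega>. c *\<^sub>R X \<omega>)"
  by (auto simp: square_integrable_def power_mult_distrib)

lemma square_integrable_diff:
  assumes "square_integrable M X" "square_integrable M Y"
  shows "square_integrable M (\<lambda>\<omega>. X \<omega> - Y \<omega>)"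
  using square_integrable_add[OF assms(1) square_integrable_scaleR[OF assms(2), of "-1"]] by simp

lemma square_integrable_cong:
  assumes "\<And>\<omega>. \<omega> \<in> space M \<Longrightarrow> X \<omega> = Y \<omega>"
  shows "square_integrable M X \<longleftrightarrow> square_integrable M Y"
proof -
  have "X \<in> borel_measurable M \<longleftrightarrow> Y \<in> borel_measurable M"
    using assms by (rule measurable_cong)
  moreover have "integrable M (\<lambda>\<omega>. (norm (X \<omega>))\<^sup>2) \<longleftrightarrow> integrable M (\<lambda>\<omega>. (norm (Y \<omega>))\<^sup>2)"
    by (rule Bochner_Integration.integrable_cong) (simp_all add: assms)
  ultimately show ?thesis by (simp add: square_integrable_def)
qed

context finite_measure
begin

lemma square_integrable_const: "square_integrable M (\<lambda>\<omega>. c)"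
  by (simp add: square_integrable_def)

text \<open>A Lipschitz map grows at most linearly: after subtracting \<open>g 0\<close> the norm is
  at most C times that of X, and the constant \<open>g 0\<close> is square integrable because the
  measure is finite. The map of interest is the gradient.\<close>

lemma square_integrable_lipschitz:
  fixes g :: "'c::euclidean_space \<Rightarrow> 'd::euclidean_space"
  assumes lip: "C-lipschitz_on UNIV g" and X: "square_integrable M X"
  shows "square_integrable M (\<lambda>\<omega>. g (X \<omega>))"
proof -
  have gm: "g \<in> borel_measurable borel"
    using lip by (intro borel_measurable_continuous_onI lipschitz_on_continuous_on)
  have Xm: "X \<in> borel_measurable M" using X by (simp add: square_integrable_def)
  have gXm: "(\<lambda>\<omega>. g (X \<omega>)) \<in> borel_measurable M" using gm Xm by measurable
  have "square_integrable M (\<lambda>\<omega>. g (X \<omega>) - g 0)"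
    unfolding square_integrable_def
  proof
    show "(\<lambda>\<omega>. g (X \<omega>) - g 0) \<in> borel_measurable M" using gXm by simp
    show "integrable M (\<lambda>\<omega>. (norm (g (X \<omega>) - g 0))\<^sup>2)"
    proof (rule Bochner_Integration.integrable_bound)
      show "integrable M (\<lambda>\<omega>. C\<^sup>2 * (norm (X \<omega>))\<^sup>2)"
        using X by (simp add: square_integrable_def)
      show "(\<lambda>\<omega>. (norm (g (X \<omega>) - g 0))\<^sup>2) \<in> borel_measurable M"
        using gXm by simp
      have "(norm (g a - g 0))\<^sup>2 \<le> C\<^sup>2 * (norm a)\<^sup>2" for a
        using power_mono[OF lipschitz_on_normD[OF lip, of a 0], of 2]
        by (simp add: power_mult_distrib)
      then show "AE \<omega> in M. norm ((norm (g (X \<omega>) - g 0))\<^sup>2) \<le> norm (C\<^sup>2 * (norm (X \<omega>))\<^sup>2)"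
        by simp
    qed
  qed
  from square_integrable_add[OF this square_integrable_const[of "g 0"]]
  show ?thesis by simp
qed

end

section \<open>Quadratic bounds, the minimizer and the gradient\<close>

lemma L_smooth_upper:
  assumes "L_smooth L f"
  shows "f y \<le> f x + grad f x \<bullet> (y - x) + L / 2 * (norm (y - x))\<^sup>2"
  using assms[unfolded L_smooth_def, rule_format, of y x]
  by (simp add: inner_diff_right norm_minus_commute)

lemma strongly_convex_lower:
  assumes "strongly_convex \<mu> f"
  shows "f x + grad f x \<bullet> (y - x) + \<mu> / 2 * (norm (y - x))\<^sup>2 \<le> f y"
  using assms[unfolded strongly_convex_def, THEN conjunct2, rule_format, of x y]
  by (simp add: norm_minus_commute)

text \<open>The lower and upper quadratic bounds around 0 share their linear term, so evaluating
  both at a unit vector compares \<mu>/2 with L/2. In the main proof this yields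
  \<open>2 \<le> k0\<close>.\<close>

lemma strong_convexity_le_smoothness:
  fixes f :: "'a::euclidean_space \<Rightarrow> real"
  assumes "strongly_convex \<mu> f" "L_smooth L f"
  shows "\<mu> \<le> L"
proof -
  obtain b :: 'a where "b \<in> Basis" using nonempty_Basis by blast
  then have "norm (b - 0) = 1" by simp
  with strongly_convex_lower[OF assms(1), of 0 b] L_smooth_upper[OF assms(2), of b 0]
  show ?thesis by simp
qed

text \<open>A gradient step of size 1/L from \<open>xs\<close> lowers f by at least |G|^2/(2L),
  which minimality permits only for G = 0.\<close>

lemma minimizer_grad_zero:
  fixes f :: "'a::euclidean_space \<Rightarrow> real"
  assumes smooth: "L_smooth L f" and L: "0 < L" and min: "is_minimizer f xs"
  shows "grad f xs = 0"
proof -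
  let ?G = "grad f xs"
  have "f (xs - (1 / L) *\<^sub>R ?G) \<le> f xs - (norm ?G)\<^sup>2 / L + (norm ?G)\<^sup>2 / (2 * L)"
    using L_smooth_upper[OF smooth, of "xs - (1 / L) *\<^sub>R ?G" xs] L
    by (simp add: power_mult_distrib power_divide power2_norm_eq_inner[symmetric])
      (simp add: power2_eq_square)
  moreover have "(norm ?G)\<^sup>2 / L = 2 * ((norm ?G)\<^sup>2 / (2 * L))" by simp
  moreover have "f xs \<le> f (xs - (1 / L) *\<^sub>R ?G)" using min by (simp add: is_minimizer_def)
  ultimately have "(norm ?G)\<^sup>2 / (2 * L) \<le> 0" by linarith
  with L have "(norm ?G)\<^sup>2 \<le> 0" by (simp add: divide_le_0_iff)
  then show ?thesis by simp
qed

text \<open>\<open>L_smooth\<close> is a one-sided bound, and convexity upgrades it. The gap f y - f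
  x - grad f x . (y - x) is at least |D|^2/(2L) and at most L/2 |y - x|^2, and comparing the two
  gives the constant L. This makes gradients along the iterates measurable and square
  integrable.\<close>

lemma grad_lipschitz:
  fixes f :: "'a::euclidean_space \<Rightarrow> real"
  assumes sc: "strongly_convex \<mu> f" and smooth: "L_smooth L f" and L: "0 < L"
  shows "L-lipschitz_on UNIV (grad f)"
proof (rule lipschitz_onI)
  have convex: "f z + grad f z \<bullet> (u - z) \<le> f u" for z u
  proof -
    have "0 \<le> \<mu> / 2 * (norm (u - z))\<^sup>2" using sc by (simp add: strongly_convex_def)
    with strongly_convex_lower[OF sc, of z u] show ?thesis by linarith
  qed
  fix x y :: 'a
  define D where "D = grad f y - grad f x"
  \<comment> \<open>A gradient step from \<open>y\<close> decreases \<open>\<lambda>z. f z - grad f x \<bullet> z\<close>, which is minimal at \<open>x\<close>.\<close>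
  define z where "z = y - (1 / L) *\<^sub>R D"
  have "f z \<le> f y - grad f y \<bullet> D / L + (norm D)\<^sup>2 / (2 * L)"
    using L_smooth_upper[OF smooth, of z y] L
    by (simp add: z_def power_mult_distrib power_divide) (simp add: power2_eq_square)
  moreover have "f x + grad f x \<bullet> (y - x) - grad f x \<bullet> D / L \<le> f z"
    using convex[of x z] by (simp add: z_def inner_diff_right)
  moreover have "grad f y \<bullet> D / L - grad f x \<bullet> D / L = (norm D)\<^sup>2 / L"
    unfolding diff_divide_distrib[symmetric] inner_diff_left[symmetric]
    by (simp only: D_def[symmetric] dot_square_norm)
  moreover have "(norm D)\<^sup>2 / L = 2 * ((norm D)\<^sup>2 / (2 * L))" by simp
  ultimately have "(norm D)\<^sup>2 / (2 * L) \<le> f y - f x - grad f x \<bullet> (y - x)"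
    by linarith
  also have "\<dots> \<le> L / 2 * (norm (y - x))\<^sup>2"
    using L_smooth_upper[OF smooth, of y x] by simp
  finally have "2 * L * ((norm D)\<^sup>2 / (2 * L)) \<le> 2 * L * (L / 2 * (norm (y - x))\<^sup>2)"
    using L by (intro mult_left_mono) auto
  then have "(norm D)\<^sup>2 \<le> (L * norm (y - x))\<^sup>2"
    using L by (simp add: power_mult_distrib) (simp add: power2_eq_square)
  then have "norm D \<le> L * norm (y - x)"
    by (rule power2_le_imp_le) (use L in simp)
  then show "dist (grad f x) (grad f y) \<le> L * dist x y"
    by (simp add: D_def dist_norm norm_minus_commute)
qed (use L in simp)

text \<open>Since the gradient vanishes at \<open>xs\<close>, smoothness there bounds f - f xs by a
  multiple of the squared distance to \<open>xs\<close>, while minimality bounds it below by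
  0.\<close>

lemma integrable_E_SC:
  fixes f :: "'a::euclidean_space \<Rightarrow> real"
  assumes M: "prob_space M" and diff: "\<forall>z. f differentiable (at z)"
    and smooth: "L_smooth L f" and L: "0 < L" and min: "is_minimizer f xs"
    and X: "square_integrable M X" and V: "square_integrable M V"
  shows "integrable M (\<lambda>\<omega>. E_SC f \<mu> xs (X \<omega>) (V \<omega>))"
proof -
  interpret prob_space M by (rule M)
  have sq: "integrable M (\<lambda>\<omega>. (norm (Z \<omega> - xs))\<^sup>2)" if "square_integrable M Z" for Z
    using square_integrable_diff[OF that square_integrable_const[of xs]]
    by (simp add: square_integrable_def)
  have "continuous_on UNIV f"
    using diff by (intro continuous_at_imp_continuous_on ballI differentiable_imp_continuous_within) auto
  then have [measurable]: "f \<in> borel_measurable borel"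
    by (rule borel_measurable_continuous_onI)
  have [measurable]: "X \<in> borel_measurable M" using X by (simp add: square_integrable_def)
  have bound: "0 \<le> f z - f xs \<and> f z - f xs \<le> L / 2 * (norm (z - xs))\<^sup>2" for z
    using min L_smooth_upper[OF smooth, of z xs] minimizer_grad_zero[OF smooth L min]
    by (simp add: is_minimizer_def)
  have "integrable M (\<lambda>\<omega>. f (X \<omega>) - f xs)"
  proof (rule Bochner_Integration.integrable_bound)
    show "integrable M (\<lambda>\<omega>. L / 2 * (norm (X \<omega> - xs))\<^sup>2)" using sq[OF X] by simp
    show "AE \<omega> in M. norm (f (X \<omega>) - f xs) \<le> norm (L / 2 * (norm (X \<omega> - xs))\<^sup>2)"
      using bound L by (intro AE_I2) (simp add: abs_of_nonneg)
  qed simp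
  then show ?thesis unfolding E_SC_def using sq[OF V] by simp
qed

section \<open>Noise evaluated at a point determined by the past\<close>

text \<open>
  Keeping the past as the sample point \<open>\<omega>\<close>, seen only through \<open>F\<close>, spares a factorization of
  the iterates through the tuple of earlier samples.
\<close>

lemma distr_fresh_sample:
  assumes M: "prob_space M" and F: "subalgebra M F" and P: "prob_space P"
    and \<xi>: "\<xi> \<in> measurable M P" "distr M P \<xi> = P"
    and indep: "prob_space.indep_set M (sets F) (sets (vimage_algebra (space M) \<xi> P))"
  shows "restr_to_subalg M F \<Otimes>\<^sub>M P = distr M (F \<Otimes>\<^sub>M P) (\<lambda>\<omega>. (\<omega>, \<xi> \<omega>))"
proof -
  interpret M: prob_space M by (rule M)
  interpret P: prob_space P by (rule P)
  interpret N: prob_space "restr_to_subalg M F" by (rule prob_space_restr_to_subalg[OF F M])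
  have id: "(\<lambda>\<omega>. \<omega>) \<in> measurable M F"
    by (intro measurable_from_subalg[OF F] measurable_ident_sets refl)
  have pair: "(\<lambda>\<omega>. (\<omega>, \<xi> \<omega>)) \<in> measurable M (F \<Otimes>\<^sub>M P)"
    by (rule measurable_Pair[OF id \<xi>(1)])
  show ?thesis
  \<comment> \<open>A product of sigma-finite measures is determined by its values on rectangles
    \<open>A \<times> B\<close>, and there the product formula is exactly the independence of
    \<open>F\<close> and the sample.\<close>
  proof (rule pair_measure_eqI)
    show "sets (restr_to_subalg M F \<Otimes>\<^sub>M P) = sets (distr M (F \<Otimes>\<^sub>M P) (\<lambda>\<omega>. (\<omega>, \<xi> \<omega>)))"
      using sets_pair_measure_cong[OF sets_restr_to_subalg[OF F] refl] by simp
    fix A B assume "A \<in> sets (restr_to_subalg M F)" and B: "B \<in> sets P"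
    then have A: "A \<in> sets F" by (simp add: sets_restr_to_subalg[OF F])
    let ?B = "\<xi> -` B \<inter> space M"
    have AM: "A \<subseteq> space M" using sets.sets_into_space[OF A] F by (simp add: subalgebra_def)
    have "emeasure (distr M (F \<Otimes>\<^sub>M P) (\<lambda>\<omega>. (\<omega>, \<xi> \<omega>))) (A \<times> B) = emeasure M (A \<inter> ?B)"
      using A B pair AM by (subst emeasure_distr) (auto intro!: arg_cong[where f="emeasure M"])
    also have "\<dots> = ennreal (M.prob A * M.prob ?B)"
      using M.indep_setD[OF indep A in_vimage_algebra[OF B]] by (simp add: M.emeasure_eq_measure)
    also have "\<dots> = emeasure M A * emeasure (distr M P \<xi>) B"
      using B \<xi>(1) by (simp add: emeasure_distr M.emeasure_eq_measure ennreal_mult)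
    finally show "emeasure (restr_to_subalg M F) A * emeasure P B =
        emeasure (distr M (F \<Otimes>\<^sub>M P) (\<lambda>\<omega>. (\<omega>, \<xi> \<omega>))) (A \<times> B)"
      by (simp add: emeasure_restr_to_subalg[OF F A] \<xi>(2))
  qed (unfold_locales)
qed

text \<open>Under the product law the past is frozen while the sample is integrated over
  \<open>P\<close>, so the moment conditions of \<open>gradient_noise\<close> apply at the fixed
  point \<open>Y \<omega>\<close>. Fubini thus replaces conditioning on the past.\<close>

lemma fresh_noise:
  fixes e :: "'a::euclidean_space \<Rightarrow> 's \<Rightarrow> 'a"
  assumes M: "prob_space M" and F: "subalgebra M F" and noise: "gradient_noise P e \<sigma>"
    and \<xi>: "\<xi> \<in> measurable M P" "distr M P \<xi> = P"
    and indep: "prob_space.indep_set M (sets F) (sets (vimage_algebra (space M) \<xi> P))"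
    and Y: "Y \<in> borel_measurable F"
  shows fresh_noise_square_integrable: "square_integrable M (\<lambda>\<omega>. e (Y \<omega>) (\<xi> \<omega>))"
    and fresh_noise_variance: "(LINT \<omega>|M. (norm (e (Y \<omega>) (\<xi> \<omega>)))\<^sup>2) \<le> \<sigma>\<^sup>2"
    and fresh_noise_orthogonal: "Q \<in> borel_measurable F \<Longrightarrow> square_integrable M Q \<Longrightarrow>
          (LINT \<omega>|M. Q \<omega> \<bullet> e (Y \<omega>) (\<xi> \<omega>)) = 0"
proof -
  let ?R = "restr_to_subalg M F"
  interpret M: prob_space M by (rule M)
  have P: "prob_space P" using noise by (simp add: gradient_noise_def)
  interpret P: prob_space P by (rule P)
  interpret R: prob_space ?R by (rule prob_space_restr_to_subalg[OF F M])
  interpret RP: pair_sigma_finite ?R P ..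
  have em [measurable]: "(\<lambda>(x, s). e x s) \<in> borel_measurable (borel \<Otimes>\<^sub>M P)"
    and e0: "\<And>x. integrable P (e x)" "\<And>x. (LINT s|P. e x s) = 0"
    and e2: "\<And>x. integrable P (\<lambda>s. (norm (e x s))\<^sup>2)" "\<And>x. (LINT s|P. (norm (e x s))\<^sup>2) \<le> \<sigma>\<^sup>2"
    using noise by (auto simp: gradient_noise_def)
  note Y[measurable]
  have YR [measurable]: "Y \<in> borel_measurable ?R" by (rule measurable_in_subalg[OF F Y])
  have joint: "?R \<Otimes>\<^sub>M P = distr M (F \<Otimes>\<^sub>M P) (\<lambda>\<omega>. (\<omega>, \<xi> \<omega>))"
    by (rule distr_fresh_sample[OF M F P \<xi> indep])
  have id: "(\<lambda>\<omega>. \<omega>) \<in> measurable M F"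
    by (intro measurable_from_subalg[OF F] measurable_ident_sets refl)
  have pair: "(\<lambda>\<omega>. (\<omega>, \<xi> \<omega>)) \<in> measurable M (F \<Otimes>\<^sub>M P)"
    by (rule measurable_Pair[OF id \<xi>(1)])
  have eF [measurable]: "(\<lambda>(\<omega>, s). e (Y \<omega>) s) \<in> borel_measurable (F \<Otimes>\<^sub>M P)"
    using measurable_compose[OF _ em, of "\<lambda>(\<omega>, s). (Y \<omega>, s)" "F \<Otimes>\<^sub>M P"]
    by (simp add: case_prod_beta')
  have sqF: "(\<lambda>z. ennreal ((norm (case z of (\<omega>, s) \<Rightarrow> e (Y \<omega>) s))\<^sup>2))
      \<in> borel_measurable (F \<Otimes>\<^sub>M P)"
    by measurable
  have sqR: "(\<lambda>z. ennreal ((norm (case z of (\<omega>, s) \<Rightarrow> e (Y \<omega>) s))\<^sup>2))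
      \<in> borel_measurable (?R \<Otimes>\<^sub>M P)"
    unfolding joint measurable_distr_eq1 by (rule sqF)
  have eM: "(\<lambda>\<omega>. e (Y \<omega>) (\<xi> \<omega>)) \<in> borel_measurable M"
    using measurable_compose[OF pair eF] by simp
  \<comment> \<open>The nonnegative integral comes first: it needs no integrability, and its bound
    by the variance supplies integrability afterwards.\<close>
  have "(\<integral>\<^sup>+\<omega>. ennreal ((norm (e (Y \<omega>) (\<xi> \<omega>)))\<^sup>2) \<partial>M) =
      (\<integral>\<^sup>+z. ennreal ((norm (case z of (\<omega>, s) \<Rightarrow> e (Y \<omega>) s))\<^sup>2) \<partial>(?R \<Otimes>\<^sub>M P))"
    unfolding joint by (subst nn_integral_distr[OF pair]) (simp_all add: sqF)
  also have "\<dots> = (\<integral>\<^sup>+\<omega>. \<integral>\<^sup>+s. ennreal ((norm (e (Y \<omega>) s))\<^sup>2) \<partial>P \<partial>?R)"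
    using P.nn_integral_fst[OF sqR] by simp
  also have "\<dots> \<le> (\<integral>\<^sup>+\<omega>. ennreal (\<sigma>\<^sup>2) \<partial>?R)"
    using e2 by (intro nn_integral_mono) (simp add: nn_integral_eq_integral ennreal_leI)
  also have "\<dots> = ennreal (\<sigma>\<^sup>2)" by (simp add: R.emeasure_space_1)
  finally have nn: "(\<integral>\<^sup>+\<omega>. ennreal ((norm (e (Y \<omega>) (\<xi> \<omega>)))\<^sup>2) \<partial>M) \<le> ennreal (\<sigma>\<^sup>2)" .
  then have "integrable M (\<lambda>\<omega>. (norm (e (Y \<omega>) (\<xi> \<omega>)))\<^sup>2)"
    using eM le_less_trans[OF nn ennreal_less_top] by (intro integrableI_bounded) auto
  with eM show si: "square_integrable M (\<lambda>\<omega>. e (Y \<omega>) (\<xi> \<omega>))"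
    by (simp add: square_integrable_def)
  show "(LINT \<omega>|M. (norm (e (Y \<omega>) (\<xi> \<omega>)))\<^sup>2) \<le> \<sigma>\<^sup>2"
    using nn eM by (intro integral_real_bounded) auto
  assume Q [measurable]: "Q \<in> borel_measurable F" and Q2: "square_integrable M Q"
  let ?g = "\<lambda>z. Q (fst z) \<bullet> (case z of (\<omega>, s) \<Rightarrow> e (Y \<omega>) s)"
  have gm: "?g \<in> borel_measurable (F \<Otimes>\<^sub>M P)" by measurable
  \<comment> \<open>Fubini for the signed integrand needs joint integrability, which is transported
    from \<open>M\<close>, where it is a product of two square-integrable vectors.\<close>
  have "integrable M (\<lambda>\<omega>. ?g (\<omega>, \<xi> \<omega>))"
    using square_integrable_inner[OF Q2 si] by simp
  then have gi: "integrable (?R \<Otimes>\<^sub>M P) ?g"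
    unfolding joint using integrable_distr_eq[OF pair gm] by simp
  have "(LINT \<omega>|M. Q \<omega> \<bullet> e (Y \<omega>) (\<xi> \<omega>)) = integral\<^sup>L (?R \<Otimes>\<^sub>M P) ?g"
    unfolding joint by (subst integral_distr[OF pair gm]) simp
  also have "\<dots> = (LINT \<omega>|?R. LINT s|P. ?g (\<omega>, s))"
    by (rule RP.integral_fst'[OF gi, symmetric])
  \<comment> \<open>For fixed \<open>\<omega>\<close> the factor \<open>Q \<omega>\<close> leaves
    the inner integral, and what remains is the mean of the noise at
    \<open>Y \<omega>\<close>.\<close>
  also have "\<dots> = 0" using e0 by simp
  finally show "(LINT \<omega>|M. Q \<omega> \<bullet> e (Y \<omega>) (\<xi> \<omega>)) = 0" .
qed

section \<open>One-step energy inequality\<close>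

text \<open>The noise is an arbitrary vector \<open>d\<close> here, so the estimate is purely
  deterministic. The vector paired with \<open>d\<close> is built from y and v alone, hence from the
  past when applied to the iterates.\<close>

lemma E_SC_step:
  fixes f :: "'a::euclidean_space \<Rightarrow> real" and x y v x' v' :: 'a
  assumes sc: "strongly_convex \<mu> f" and smooth: "L_smooth L f" and L: "0 < L"
    and h: "0 < h" "h \<le> 1 / sqrt L" and a: "a = h * sqrt \<mu>" "a \<le> 1"
    and w: "w = a / (1 + a)"
    and y: "y = (1 - w) *\<^sub>R x + w *\<^sub>R v"
    and x': "x' - x = w *\<^sub>R (v - x) - (h / sqrt L) *\<^sub>R (grad f y + d)"
    and v': "v' - v = w *\<^sub>R (x - v) - (h / sqrt \<mu>) *\<^sub>R (grad f y + d)"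
  shows "E_SC f \<mu> xs x' v' \<le> (1 - a) * E_SC f \<mu> xs x v
     + ((2 * h\<^sup>2 - h / sqrt L) *\<^sub>R grad f y - a *\<^sub>R ((1 - a) *\<^sub>R (v - xs) + a *\<^sub>R (y - xs))) \<bullet> d
     + h\<^sup>2 * (norm d)\<^sup>2"
proof -
  define G where "G = grad f y"
  define g where "g = G + d"
  \<comment> \<open>\<open>p\<close> is the new v relative to \<open>xs\<close>, before its gradient
    step.\<close>
  define p where "p = (1 - a) *\<^sub>R (v - xs) + a *\<^sub>R (y - xs)"
  have \<mu>: "0 < \<mu>" using sc by (simp add: strongly_convex_def)
  have a0: "0 < a" using a \<mu> h by simp
  \<comment> \<open>The choice of \<open>w\<close> is what gives \<open>a * (1 - w) = w\<close>:
    measured from y, v moves towards y by the fraction \<open>a\<close>, and y - x is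
    \<open>a\<close> times v - y.\<close>
  have w1: "1 - w = 1 / (1 + a)" using a0 by (simp add: w field_simps)
  have wa: "a * (1 - w) = w" using a0 by (simp add: w1) (simp add: w)
  have yx: "y - x = w *\<^sub>R (v - x)" by (simp add: y algebra_simps)
  have yv: "y - v = (1 - w) *\<^sub>R (x - v)" by (simp add: y algebra_simps)
  have wxv: "w *\<^sub>R (x - v) = a *\<^sub>R (y - v)" by (simp add: yv wa)
  have yxa: "y - x = a *\<^sub>R (v - y)" using wxv yx by (metis minus_diff_eq scaleR_minus_right)
  have x'y: "x' = y - (h / sqrt L) *\<^sub>R g"
  proof -
    have "x' - x = (y - x) - (h / sqrt L) *\<^sub>R g" using x' by (simp add: yx g_def G_def)
    then show ?thesis by (simp add: algebra_simps)
  qed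
  have v'p: "v' - xs = p - (h / sqrt \<mu>) *\<^sub>R g"
  proof -
    have "v' - v = a *\<^sub>R (y - v) - (h / sqrt \<mu>) *\<^sub>R g" using v' by (simp add: wxv g_def G_def)
    then have "v' - xs = (v - xs) + a *\<^sub>R (y - v) - (h / sqrt \<mu>) *\<^sub>R g"
      by (simp add: algebra_simps)
    also have "(v - xs) + a *\<^sub>R (y - v) = p" by (simp add: p_def algebra_simps)
    finally show ?thesis .
  qed
  \<comment> \<open>The step size \<open>h / sqrt L\<close> turns the smoothness term into h^2/2
    |g|^2. The v-part contributes the same amount in \<open>s2\<close>, for a total of h^2
    |g|^2.\<close>
  have "f x' \<le> f y - (h / sqrt L) * (G \<bullet> g) + L / 2 * (norm ((h / sqrt L) *\<^sub>R g))\<^sup>2"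
    using L_smooth_upper[OF smooth, of x' y] by (simp add: x'y G_def)
  also have "L / 2 * (norm ((h / sqrt L) *\<^sub>R g))\<^sup>2 = h\<^sup>2 / 2 * (norm g)\<^sup>2"
    using L by (simp add: power_mult_distrib power_divide)
  finally have s1: "f x' \<le> f y - (h / sqrt L) * (G \<bullet> g) + h\<^sup>2 / 2 * (norm g)\<^sup>2" .
  have "(norm (p - c *\<^sub>R g))\<^sup>2 = (norm p)\<^sup>2 - 2 * c * (p \<bullet> g) + c\<^sup>2 * (norm g)\<^sup>2" for c
    unfolding power2_norm_eq_inner
    by (simp add: inner_simps inner_commute power2_eq_square algebra_simps)
  from this[of "h / sqrt \<mu>"] have "\<mu> / 2 * (norm (v' - xs))\<^sup>2 = \<mu> / 2 * (norm p)\<^sup>2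
      - (\<mu> * (h / sqrt \<mu>)) * (p \<bullet> g) + (\<mu> * (h / sqrt \<mu>)\<^sup>2) / 2 * (norm g)\<^sup>2"
    unfolding v'p by (simp only:) (simp add: algebra_simps)
  moreover have "\<mu> * (h / sqrt \<mu>) = a"
    using \<mu> real_sqrt_mult_self[of \<mu>] by (simp add: a(1) field_simps)
  moreover have "\<mu> * (h / sqrt \<mu>)\<^sup>2 = h\<^sup>2" using \<mu> by (simp add: power_divide)
  ultimately have s2: "\<mu> / 2 * (norm (v' - xs))\<^sup>2 =
      \<mu> / 2 * (norm p)\<^sup>2 - a * (p \<bullet> g) + h\<^sup>2 / 2 * (norm g)\<^sup>2"
    by (simp only:)
  \<comment> \<open>The right-hand side is the convexity defect of the squared norm at the convex
    combination \<open>p\<close>.\<close>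
  have "(1 - a) * (norm (v - xs))\<^sup>2 + a * (norm (y - xs))\<^sup>2 - (norm p)\<^sup>2
      = a * (1 - a) * (norm ((v - xs) - (y - xs)))\<^sup>2"
    unfolding p_def
    by (simp only: power2_norm_eq_inner inner_add_left inner_add_right inner_diff_left[of "v - xs" "y - xs"]
        inner_diff_right[of _ "v - xs" "y - xs"] inner_scaleR_left inner_scaleR_right
        inner_commute[of "y - xs" "v - xs"]) (simp add: algebra_simps)
  also have "\<dots> \<ge> 0" using a0 a by simp
  finally have "(norm p)\<^sup>2 \<le> (1 - a) * (norm (v - xs))\<^sup>2 + a * (norm (y - xs))\<^sup>2" by simp
  from mult_left_mono[OF this, of "\<mu> / 2"] \<mu> have s3: "\<mu> / 2 * (norm p)\<^sup>2
      \<le> (1 - a) * (\<mu> / 2 * (norm (v - xs))\<^sup>2) + a * (\<mu> / 2 * (norm (y - xs))\<^sup>2)"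
    by (simp only: distrib_left mult.left_commute)
  \<comment> \<open>This splits the pairing with the gradient into a part towards \<open>xs\<close>
    of weight \<open>a\<close> and a part towards x of weight \<open>1 - a\<close>, each controlled
    by strong convexity at y.\<close>
  have "a *\<^sub>R p = a *\<^sub>R (y - xs) + (1 - a) *\<^sub>R (y - x)"
    unfolding yxa by (simp add: p_def algebra_simps)
  then have s4: "a * (p \<bullet> G) = a * ((y - xs) \<bullet> G) + (1 - a) * ((y - x) \<bullet> G)"
    by (metis inner_add_left inner_scaleR_left)
  have "- ((y - xs) \<bullet> G) \<le> f xs - f y - \<mu> / 2 * (norm (y - xs))\<^sup>2"
    using strongly_convex_lower[OF sc, of y xs]
    by (simp add: G_def norm_minus_commute inner_simps inner_commute)
  then have s5: "a * (- ((y - xs) \<bullet> G)) \<le> a * (f xs - f y - \<mu> / 2 * (norm (y - xs))\<^sup>2)"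
    using a0 by (intro mult_left_mono) auto
  have "0 \<le> \<mu> / 2 * (norm (x - y))\<^sup>2" using \<mu> by simp
  then have "- ((y - x) \<bullet> G) \<le> f x - f y"
    using strongly_convex_lower[OF sc, of y x]
    by (simp add: G_def inner_diff_left inner_diff_right inner_commute)
  then have s6: "(1 - a) * (- ((y - x) \<bullet> G)) \<le> (1 - a) * (f x - f y)"
    using a by (intro mult_left_mono) auto
  \<comment> \<open>The only use of \<open>h \<le> 1 / sqrt L\<close>: the descent from the x-step
    absorbs h^2 |G|^2, leaving only terms that contain \<open>d\<close>.\<close>
  have "h * h \<le> h * (1 / sqrt L)" using h by (intro mult_left_mono) auto
  then have "(h\<^sup>2 - h / sqrt L) * (norm G)\<^sup>2 \<le> 0"
    by (intro mult_nonpos_nonneg) (simp_all add: power2_eq_square)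
  then have "h\<^sup>2 * (norm G)\<^sup>2 \<le> (h / sqrt L) * (norm G)\<^sup>2" by (simp add: left_diff_distrib)
  moreover have "(norm g)\<^sup>2 = (norm G)\<^sup>2 + 2 * (G \<bullet> d) + (norm d)\<^sup>2"
    by (simp add: g_def power2_norm_eq_inner inner_simps inner_commute)
  then have "h\<^sup>2 * (norm g)\<^sup>2 = h\<^sup>2 * (norm G)\<^sup>2 + 2 * h\<^sup>2 * (G \<bullet> d) + h\<^sup>2 * (norm d)\<^sup>2"
    by (simp add: algebra_simps)
  moreover have "(h / sqrt L) * (G \<bullet> g) = (h / sqrt L) * (norm G)\<^sup>2 + (h / sqrt L) * (G \<bullet> d)"
    by (simp only: g_def power2_norm_eq_inner inner_add_right distrib_left)
  ultimately have s7: "h\<^sup>2 * (norm g)\<^sup>2 - (h / sqrt L) * (G \<bullet> g)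
      \<le> 2 * h\<^sup>2 * (G \<bullet> d) - (h / sqrt L) * (G \<bullet> d) + h\<^sup>2 * (norm d)\<^sup>2"
    by linarith
  define NV where "NV = \<mu> / 2 * (norm (v - xs))\<^sup>2"
  define NY where "NY = \<mu> / 2 * (norm (y - xs))\<^sup>2"
  \<comment> \<open>The values f y cancel because the weights \<open>a\<close> and
    \<open>1 - a\<close> sum to 1, and the term \<open>a * NY\<close> from \<open>s3\<close> is
    cancelled by the strong convexity gain in \<open>s5\<close>.\<close>
  have s8: "f y - f xs - a * (p \<bullet> G) + \<mu> / 2 * (norm p)\<^sup>2 \<le> (1 - a) * (f x - f xs + NV)"
    using s3[folded NV_def NY_def] s4 s5[folded NY_def] s6 by (simp add: algebra_simps)
  have s9: "a * (p \<bullet> g) = a * (p \<bullet> G) + a * (p \<bullet> d)"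
    by (simp add: g_def inner_simps algebra_simps)
  have "h\<^sup>2 / 2 * (norm g)\<^sup>2 + h\<^sup>2 / 2 * (norm g)\<^sup>2 = h\<^sup>2 * (norm g)\<^sup>2" by simp
  with s1 s2 s7 s8 s9 have "f x' - f xs + \<mu> / 2 * (norm (v' - xs))\<^sup>2
      \<le> (1 - a) * (f x - f xs + NV)
        + (2 * h\<^sup>2 * (G \<bullet> d) - (h / sqrt L) * (G \<bullet> d) - a * (p \<bullet> d)) + h\<^sup>2 * (norm d)\<^sup>2"
    by linarith
  then show ?thesis
    unfolding E_SC_def G_def[symmetric] p_def[symmetric] NV_def[symmetric]
    by (simp only: inner_diff_left inner_scaleR_left left_diff_distrib)
qed

section \<open>Adapted iterates and the rate in expectation\<close>

theorem proposition3p7: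
  fixes f :: "real ^ 'n \<Rightarrow> real"
    and \<mu> L \<sigma> k0 :: real
    and xs x0 v0 :: "real ^ 'n"
    and M :: "'w measure"
    and P :: "'s measure"
    and e :: "real ^ 'n \<Rightarrow> 's \<Rightarrow> real ^ 'n"
    and \<xi> :: "nat \<Rightarrow> 'w \<Rightarrow> 's"
    and h w :: "nat \<Rightarrow> real"
    and x y v :: "nat \<Rightarrow> 'w \<Rightarrow> real ^ 'n"
  assumes "\<forall>z. f differentiable (at z)"
    and "strongly_convex \<mu> f"
    and "L_smooth L f"
    and "is_minimizer f xs"
    and "prob_space M"
    and "gradient_noise P e \<sigma>"
    and "fresh_samples M P \<xi>"
    and "0 < E_SC f \<mu> xs x0 v0"
    and "E_SC f \<mu> xs x0 v0 \<le> 2 * \<sigma>\<^sup>2 / sqrt (\<mu> * L)"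
    and "k0 = max (2 * sqrt (L / \<mu>)) (4 * \<sigma>\<^sup>2 / (\<mu> * E_SC f \<mu> xs x0 v0))"
    and "\<forall>k. h k = 2 / (sqrt \<mu> * (real k + k0))"
    and "\<forall>k. w k = h k * sqrt \<mu> / (1 + h k * sqrt \<mu>)"
    and "\<forall>\<omega>\<in>space M. x 0 \<omega> = x0 \<and> v 0 \<omega> = v0"
    and "\<forall>k. \<forall>\<omega>\<in>space M. y k \<omega> = (1 - w k) *\<^sub>R x k \<omega> + w k *\<^sub>R v k \<omega>"
    and "\<forall>k. \<forall>\<omega>\<in>space M. x (Suc k) \<omega> - x k \<omega> =
           w k *\<^sub>R (v k \<omega> - x k \<omega>)
           - (h k / sqrt L) *\<^sub>R (grad f (y k \<omega>) + e (y k \<omega>) (\<xi> k \<omega>))"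
    and "\<forall>k. \<forall>\<omega>\<in>space M. v (Suc k) \<omega> - v k \<omega> =
           w k *\<^sub>R (x k \<omega> - v k \<omega>)
           - (h k / sqrt \<mu>) *\<^sub>R (grad f (y k \<omega>) + e (y k \<omega>) (\<xi> k \<omega>))"
  shows "\<forall>k. integrable M (\<lambda>\<omega>. E_SC f \<mu> xs (x k \<omega>) (v k \<omega>)) \<and>
             (LINT \<omega>|M. E_SC f \<mu> xs (x k \<omega>) (v k \<omega>)) \<le> 4 * \<sigma>\<^sup>2 / (\<mu> * (real k + k0))"
proof -
  note diff = assms(1) and sc = assms(2) and smooth = assms(3) and min = assms(4) and M = assms(5)
    and noise = assms(6) and fresh = assms(7) and E0 = assms(8,9) and k0 = assms(10)
  interpret prob_space M by (rule M)
  have \<mu>: "0 < \<mu>" using sc by (simp add: strongly_convex_def)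
  have \<mu>L: "\<mu> \<le> L" by (rule strong_convexity_le_smoothness[OF sc smooth])
  have L: "0 < L" using \<mu> \<mu>L by simp
  have k0_ge: "2 * sqrt (L / \<mu>) \<le> k0" using k0 by simp
  have "1 \<le> sqrt (L / \<mu>)" using \<mu> \<mu>L by simp
  with k0_ge have k0_2: "2 \<le> k0" by linarith
  define a where "a k = h k * sqrt \<mu>" for k
  have h: "h k = 2 / (sqrt \<mu> * (real k + k0))" for k using assms(11) by simp
  have ak: "a k = 2 / (real k + k0)" for k using \<mu> by (simp add: a_def h)
  have a1: "a k \<le> 1" for k using k0_2 by (simp add: ak)
  have h0: "0 < h k" for k using \<mu> k0_2 by (simp add: h)
  have hL: "h k \<le> 1 / sqrt L" for k
  \<comment> \<open>The first entry of the maximum defining \<open>k0\<close> is exactly this bound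
    at k = 0; later steps are shorter.\<close>
  proof -
    have "2 * sqrt L = sqrt \<mu> * (2 * sqrt (L / \<mu>))" using \<mu> by (simp add: real_sqrt_divide)
    also have "\<dots> \<le> sqrt \<mu> * (real k + k0)" using k0_ge \<mu> by (intro mult_left_mono) auto
    finally have "2 * sqrt L \<le> sqrt \<mu> * (real k + k0)" .
    moreover have "0 < sqrt \<mu> * (real k + k0)" using \<mu> k0_2 by simp
    ultimately show ?thesis unfolding h using L by (simp add: divide_simps mult.commute)
  qed
  have hsq: "(h k)\<^sup>2 = 4 / (\<mu> * (real k + k0)\<^sup>2)" for k
    using \<mu> by (simp add: h power_divide power_mult_distrib)
  \<comment> \<open>The past strictly before step k. For k = 0 the tuple is constant, so
    \<open>F 0\<close> is trivial and it is the deterministic start that makes \<open>x 0\<close>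
    and \<open>v 0\<close> measurable.\<close>
  define F where "F k = vimage_algebra (space M) (\<lambda>\<omega>. \<lambda>i\<in>{..<k}. \<xi> i \<omega>) (Pi\<^sub>M {..<k} (\<lambda>_. P))" for k
  have \<xi>: "\<xi> k \<in> measurable M P" "distr M P (\<xi> k) = P"
    and indep: "indep_set (sets (F k)) (sets (vimage_algebra (space M) (\<xi> k) P))" for k
    using fresh by (auto simp: fresh_samples_def F_def)
  have tuple: "(\<lambda>\<omega>. \<lambda>i\<in>{..<k}. \<xi> i \<omega>) \<in> measurable M (Pi\<^sub>M {..<k} (\<lambda>_. P))" for k
    using \<xi>(1) by (intro measurable_restrict)
  have spF: "space (F k) = space M" for k by (simp add: F_def)
  have subalg: "subalgebra M (F k)" for k
    unfolding subalgebra_def F_def using sets_image_in_sets[OF refl tuple] by simp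
  have tupleF: "(\<lambda>\<omega>. \<lambda>i\<in>{..<k}. \<xi> i \<omega>) \<in> measurable (F k) (Pi\<^sub>M {..<k} (\<lambda>_. P))" for k
    unfolding F_def by (rule measurable_vimage_algebra1) (use measurable_space[OF tuple] in auto)
  have \<xi>F: "\<xi> i \<in> measurable (F k) P" if "i < k" for i k
  proof -
    have "(\<lambda>\<omega>. (\<lambda>i\<in>{..<k}. \<xi> i \<omega>) i) \<in> measurable (F k) P"
      by (rule measurable_compose[OF tupleF measurable_component_singleton]) (use that in simp)
    then show ?thesis using that by simp
  qed
  \<comment> \<open>The filtration is increasing, since the shorter tuple is a restriction of the
    longer one.\<close>
  have up: "Z \<in> borel_measurable (F (Suc k))" if "Z \<in> borel_measurable (F k)"
    for Z :: "'w \<Rightarrow> real ^ 'n" and k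
  proof -
    have "(\<lambda>\<omega>. \<omega>) \<in> measurable (F (Suc k)) (F k)"
      unfolding F_def[of k]
      by (rule measurable_vimage_algebra2) (auto simp: spF intro!: measurable_restrict \<xi>F)
    from measurable_compose[OF this that] show ?thesis .
  qed
  have em [measurable]: "(\<lambda>(x, s). e x s) \<in> borel_measurable (borel \<Otimes>\<^sub>M P)"
    using noise by (simp add: gradient_noise_def)
  have lip: "L-lipschitz_on UNIV (grad f)" by (rule grad_lipschitz[OF sc smooth L])
  have gradm [measurable]: "grad f \<in> borel_measurable borel"
    using lip by (intro borel_measurable_continuous_onI lipschitz_on_continuous_on)
  define D where "D k \<omega> = e (y k \<omega>) (\<xi> k \<omega>)" for k \<omega>
  \<comment> \<open>The recursion is given only on \<open>space M\<close>, so measurability and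
    square integrability are transferred by congruence there.\<close>
  have y: "y k \<omega> = (1 - w k) *\<^sub>R x k \<omega> + w k *\<^sub>R v k \<omega>" if "\<omega> \<in> space M" for k \<omega>
    using assms(14) that by blast
  have x': "x (Suc k) \<omega> = x k \<omega> + (w k *\<^sub>R (v k \<omega> - x k \<omega>) - (h k / sqrt L) *\<^sub>R (grad f (y k \<omega>) + D k \<omega>))"
    if "\<omega> \<in> space M" for k \<omega>
    using assms(15)[rule_format, OF that, of k] unfolding D_def by (metis diff_add_cancel add.commute)
  have v': "v (Suc k) \<omega> = v k \<omega> + (w k *\<^sub>R (x k \<omega> - v k \<omega>) - (h k / sqrt \<mu>) *\<^sub>R (grad f (y k \<omega>) + D k \<omega>))"
    if "\<omega> \<in> space M" for k \<omega>
    using assms(16)[rule_format, OF that, of k] unfolding D_def by (metis diff_add_cancel add.commute)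
  have yF: "y k \<in> borel_measurable (F k)"
    if "x k \<in> borel_measurable (F k)" "v k \<in> borel_measurable (F k)" for k
  proof -
    have "(\<lambda>\<omega>. (1 - w k) *\<^sub>R x k \<omega> + w k *\<^sub>R v k \<omega>) \<in> borel_measurable (F k)"
      using that by simp
    then show ?thesis by (subst measurable_cong[where g="\<lambda>\<omega>. (1 - w k) *\<^sub>R x k \<omega> + w k *\<^sub>R v k \<omega>"])
        (simp_all add: spF y)
  qed
  have yS: "square_integrable M (y k)"
    if "square_integrable M (x k)" "square_integrable M (v k)" for k
    using square_integrable_add[OF that[THEN square_integrable_scaleR]]
    by (subst square_integrable_cong[OF y])
  \<comment> \<open>Both properties go through one induction: square integrability of the noise at
    step k needs \<open>y k\<close> to be measurable with respect to \<open>F k\<close>.\<close>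
  have state: "x k \<in> borel_measurable (F k) \<and> v k \<in> borel_measurable (F k) \<and>
      square_integrable M (x k) \<and> square_integrable M (v k)" for k
  proof (induction k)
    case 0
    have "x 0 \<in> borel_measurable (F 0)"
      by (subst measurable_cong[where g="\<lambda>_. x0"]) (simp_all add: spF assms(13))
    moreover have "v 0 \<in> borel_measurable (F 0)"
      by (subst measurable_cong[where g="\<lambda>_. v0"]) (simp_all add: spF assms(13))
    moreover have "square_integrable M (x 0)"
      by (subst square_integrable_cong[where Y="\<lambda>_. x0"]) (simp_all add: assms(13) square_integrable_const)
    moreover have "square_integrable M (v 0)"
      by (subst square_integrable_cong[where Y="\<lambda>_. v0"]) (simp_all add: assms(13) square_integrable_const)
    ultimately show ?case by blast
  next
    case (Suc k)
    then have IH: "x k \<in> borel_measurable (F k)" "v k \<in> borel_measurable (F k)"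
      "square_integrable M (x k)" "square_integrable M (v k)" by auto
    note ymeas = yF[OF IH(1,2)]
    note [measurable] = up[OF IH(1)] up[OF IH(2)] up[OF ymeas] \<xi>F[OF lessI, of k]
    have [measurable]: "D k \<in> borel_measurable (F (Suc k))"
      using measurable_compose[OF _ em, of "\<lambda>\<omega>. (y k \<omega>, \<xi> k \<omega>)" "F (Suc k)"]
      by (simp add: D_def[abs_def])
    have "x (Suc k) \<in> borel_measurable (F (Suc k))"
      by (subst measurable_cong[OF x']) (simp_all add: spF)
    moreover have "v (Suc k) \<in> borel_measurable (F (Suc k))"
      by (subst measurable_cong[OF v']) (simp_all add: spF)
    moreover have "square_integrable M (D k)"
      unfolding D_def[abs_def]
      by (rule fresh_noise_square_integrable[OF M subalg noise \<xi> indep ymeas])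
    note si = IH(3,4) square_integrable_lipschitz[OF lip yS[OF IH(3,4)]] this
    have "square_integrable M (x (Suc k))"
      by (subst square_integrable_cong[OF x'])
        (auto intro!: square_integrable_add square_integrable_diff square_integrable_scaleR si)
    moreover have "square_integrable M (v (Suc k))"
      by (subst square_integrable_cong[OF v'])
        (auto intro!: square_integrable_add square_integrable_diff square_integrable_scaleR si)
    ultimately show ?case by blast
  qed
  define EE where "EE k \<omega> = E_SC f \<mu> xs (x k \<omega>) (v k \<omega>)" for k \<omega>
  have int: "integrable M (EE k)" for k
    unfolding EE_def[abs_def] using state by (intro integrable_E_SC[OF M diff smooth L min]) auto
  have step: "integral\<^sup>L M (EE (Suc k)) \<le> (1 - a k) * integral\<^sup>L M (EE k) + (h k)\<^sup>2 * \<sigma>\<^sup>2" for k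
  proof -
    have st: "x k \<in> borel_measurable (F k)" "v k \<in> borel_measurable (F k)"
      "square_integrable M (x k)" "square_integrable M (v k)" using state by auto
    note [measurable] = st(1,2) yF[OF st(1,2)]
    define Q where "Q \<omega> = (2 * (h k)\<^sup>2 - h k / sqrt L) *\<^sub>R grad f (y k \<omega>)
        - a k *\<^sub>R ((1 - a k) *\<^sub>R (v k \<omega> - xs) + a k *\<^sub>R (y k \<omega> - xs))" for \<omega>
    have QF: "Q \<in> borel_measurable (F k)" unfolding Q_def[abs_def] by simp
    have QS: "square_integrable M Q"
      unfolding Q_def[abs_def]
      by (intro square_integrable_add square_integrable_diff square_integrable_scaleR
          square_integrable_const square_integrable_lipschitz[OF lip] yS st)
    note args = M subalg noise \<xi> indep yF[OF st(1,2)]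
    have DS: "square_integrable M (D k)"
      unfolding D_def[abs_def] by (rule fresh_noise_square_integrable[OF args])
    have i1: "integrable M (\<lambda>\<omega>. Q \<omega> \<bullet> D k \<omega>)" by (rule square_integrable_inner[OF QS DS])
    have i2: "integrable M (\<lambda>\<omega>. (norm (D k \<omega>))\<^sup>2)" using DS by (simp add: square_integrable_def)
    have "integral\<^sup>L M (EE (Suc k))
        \<le> (LINT \<omega>|M. (1 - a k) * EE k \<omega> + Q \<omega> \<bullet> D k \<omega> + (h k)\<^sup>2 * (norm (D k \<omega>))\<^sup>2)"
    proof (rule integral_mono)
      fix \<omega> assume \<omega>: "\<omega> \<in> space M"
      show "EE (Suc k) \<omega> \<le> (1 - a k) * EE k \<omega> + Q \<omega> \<bullet> D k \<omega> + (h k)\<^sup>2 * (norm (D k \<omega>))\<^sup>2"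
        unfolding EE_def Q_def
        by (rule E_SC_step[OF sc smooth L h0 hL a_def a1 _ y[OF \<omega>]])
          (simp_all add: x'[OF \<omega>] v'[OF \<omega>] assms(12) a_def)
    qed (use int i1 i2 in simp_all)
    also have "\<dots> = (1 - a k) * integral\<^sup>L M (EE k) + (LINT \<omega>|M. Q \<omega> \<bullet> D k \<omega>)
        + (h k)\<^sup>2 * (LINT \<omega>|M. (norm (D k \<omega>))\<^sup>2)"
      using int i1 i2 by simp
    also have "(LINT \<omega>|M. Q \<omega> \<bullet> D k \<omega>) = 0"
      unfolding D_def by (rule fresh_noise_orthogonal[OF args QF QS])
    also have "(h k)\<^sup>2 * (LINT \<omega>|M. (norm (D k \<omega>))\<^sup>2) \<le> (h k)\<^sup>2 * \<sigma>\<^sup>2"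
      unfolding D_def by (intro mult_left_mono fresh_noise_variance[OF args]) simp
    finally show ?thesis by simp
  qed
  define B where "B = 4 * \<sigma>\<^sup>2 / \<mu>"
  have B0: "0 \<le> B" using \<mu> by (simp add: B_def)
  have "integral\<^sup>L M (EE k) \<le> B / (real k + k0)" for k
  proof (induction k)
    case 0
    let ?E = "E_SC f \<mu> xs x0 v0"
    have "integral\<^sup>L M (EE 0) = (LINT \<omega>|M. ?E)"
      using assms(13) by (intro Bochner_Integration.integral_cong) (simp_all add: EE_def)
    also have "\<dots> = ?E" by (simp add: prob_space)
    also have "?E \<le> B / k0"
    \<comment> \<open>If the first entry attains the maximum, \<open>B / k0\<close> is the assumed
      upper bound on the initial energy; otherwise \<open>k0\<close> is chosen so that
      \<open>B / k0\<close> equals that energy.\<close>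
    proof (cases "k0 = 2 * sqrt (L / \<mu>)")
      case True
      have "sqrt \<mu> * sqrt \<mu> = \<mu>" using \<mu> by simp
      then have "B / k0 = 2 * \<sigma>\<^sup>2 / sqrt (\<mu> * L)"
        using \<mu> L by (simp add: True B_def real_sqrt_divide real_sqrt_mult field_simps)
      then show ?thesis using E0(2) by simp
    next
      case False
      then have "k0 = B / ?E" using k0 by (simp add: B_def max_def split: if_splits)
      then show ?thesis using E0(1) k0_2 by (simp add: field_simps)
    qed
    finally show ?case by simp
  next
    case (Suc k)
    define t where "t = real k + k0"
    have t: "2 \<le> t" using k0_2 by (simp add: t_def)
    have "integral\<^sup>L M (EE (Suc k)) \<le> (1 - a k) * integral\<^sup>L M (EE k) + (h k)\<^sup>2 * \<sigma>\<^sup>2"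
      by (rule step)
    \<comment> \<open>Inserting the induction hypothesis preserves the inequality because
      \<open>a k \<le> 1\<close>.\<close>
    also have "\<dots> \<le> (1 - a k) * (B / t) + (h k)\<^sup>2 * \<sigma>\<^sup>2"
      using Suc a1[of k] by (intro add_right_mono mult_left_mono) (simp_all add: t_def)
    also have "\<dots> = B * ((t - 1) / t\<^sup>2)"
      using t \<mu> unfolding ak hsq t_def[symmetric] B_def
      by (simp add: field_simps power2_eq_square)
    also have "\<dots> \<le> B * (1 / (t + 1))"
    proof (rule mult_left_mono[OF _ B0])
      have "(t - 1) * (t + 1) \<le> t\<^sup>2" by (simp add: algebra_simps power2_eq_square)
      then show "(t - 1) / t\<^sup>2 \<le> 1 / (t + 1)" using t by (simp add: field_simps)
    qed
    finally show ?case by (simp add: t_def add.commute add.left_commute)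
  qed
  then show ?thesis
    using int unfolding EE_def[abs_def] B_def by (simp add: mult.commute)
qed

end
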